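(* For all integers $k, \ell \geq 1$, $$Q_{132}^{(k,0,0,\ell)}(t,x) = \frac{C_\ell t^\ell + \sum_{j=0}^{\ell -1} C_j t^j \left(1 -tQ_{132}^{(k-1,0,0,0)}(t,x)+t\left(Q_{132}^{(k-1,0,0,\ell-j)}(t,x)-\sum_{s=0}^{\ell -j -1}C_s t^s\right)\right)}{1-tQ_{132}^{(k-1,0,0,0)}(t,x)}$$ as formal power series in $t$ with coefficients in $\mathbb{Z}[x]$.
   Context: Let $\mathbb{N}=\{0,1,2,\ldots\}$ and let $S_n$ be the set of permutations $\sigma=\sigma_1\cdots\sigma_n$ of $\{1,\ldots,n\}$ in one-line notation. $S_n(132)$ denotes the set of $\sigma\in S_n$ that avoid the pattern $132$, i.e. there are no indices $i_1<i_2<i_3$ with $\sigma_{i_1}<\sigma_{i_3}<\sigma_{i_2}$. For $a,b,c,d\in\mathbb{N}$ and $\sigma\in S_n$, say that $\sigma_i$ matches the quadrant marked mesh pattern $\mathrm{MMP}(a,b,c,d)$ in $\sigma$ if: at least $a$ indices $j>i$ have $\sigma_j>\sigma_i$; at least $b$ indices $j<i$ have $\sigma_j>\sigma_i$; at least $c$ indices $j<i$ have $\sigma_j<\sigma_i$; and at least $d$ indices $j>i$ have $\sigma_j<\sigma_i$. Let $\mathrm{mmp}^{(a,b,c,d)}(\sigma)$ be the number of $i$ such that $\sigma_i$ matches $\mathrm{MMP}(a,b,c,d)$ in $\sigma$. Define $Q_{n,132}^{(a,b,c,d)}(x)=\sum_{\sigma\in S_n(132)}x^{\mathrm{mmp}^{(a,b,c,d)}(\sigma)}$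 for $n\geq 1$, and $Q_{132}^{(a,b,c,d)}(t,x)=1+\sum_{n\geq 1}t^n Q_{n,132}^{(a,b,c,d)}(x)$. $C_n=\frac{1}{n+1}\binom{2n}{n}$ is the $n$-th Catalan number. *)

theory Defs
  imports
    "HOL-Computational_Algebra.Formal_Power_Series"
    "HOL-Computational_Algebra.Polynomial"
    "HOL-Combinatorics.Multiset_Permutations"
begin

definition avoids_132 :: "nat list \<Rightarrow> bool" where
  "avoids_132 \<sigma> \<longleftrightarrow>
     \<not> (\<exists>i1 i2 i3. i1 < i2 \<and> i2 < i3 \<and> i3 < length \<sigma> \<and>
          \<sigma> ! i1 < \<sigma> ! i3 \<and> \<sigma> ! i3 < \<sigma> ! i2)"

(* Permutations are words in one-line notation; list positions count from 0, values from 1. *)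
definition S132 :: "nat \<Rightarrow> nat list set" where
  "S132 n = {\<sigma> \<in> permutations_of_set {1..n}. avoids_132 \<sigma>}"

definition matches_MMP :: "nat \<Rightarrow> nat \<Rightarrow> nat \<Rightarrow> nat \<Rightarrow> nat list \<Rightarrow> nat \<Rightarrow> bool" where
  "matches_MMP a b c d \<sigma> i \<longleftrightarrow>
     a \<le> card {j. i < j \<and> j < length \<sigma> \<and> \<sigma> ! j > \<sigma> ! i} \<and>
     b \<le> card {j. j < i \<and> \<sigma> ! j > \<sigma> ! i} \<and>
     c \<le> card {j. j < i \<and> \<sigma> ! j < \<sigma> ! i} \<and>
     d \<le> card {j. i < j \<and> j < length \<sigma> \<and> \<sigma> ! j < \<sigma> ! i}"

definition mmp :: "nat \<Rightarrow> nat \<Rightarrow> nat \<Rightarrow> nat \<Rightarrow> nat list \<Rightarrow> nat" where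
  "mmp a b c d \<sigma> = card {i. i < length \<sigma> \<and> matches_MMP a b c d \<sigma> i}"

(* The variable x is that of int poly, the variable t is fps_X. *)
definition Qn132 :: "nat \<Rightarrow> nat \<Rightarrow> nat \<Rightarrow> nat \<Rightarrow> nat \<Rightarrow> int poly" where
  "Qn132 a b c d n = (\<Sum>\<sigma>\<in>S132 n. monom 1 (mmp a b c d \<sigma>))"

definition Q132 :: "nat \<Rightarrow> nat \<Rightarrow> nat \<Rightarrow> nat \<Rightarrow> int poly fps" where
  "Q132 a b c d = Abs_fps (\<lambda>n. if n = 0 then 1 else Qn132 a b c d n)"

definition catalan :: "nat \<Rightarrow> nat" where
  "catalan n = ((2 * n) choose n) div (n + 1)"

lemma catalan_exact: "(n + 1) * catalan n = (2 * n) choose n"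
proof -
  have "(n + 1) * ((2 * n) choose (n + 1)) = n * ((2 * n) choose n)"
    using binomial_absorb_comp[of "2 * n" n] binomial_absorption[of n "2 * n"] by auto
  hence "(n + 1) dvd n * ((2 * n) choose n)"
    by (metis dvd_triv_left)
  moreover have "coprime (n + 1) n"
    by simp
  ultimately have "(n + 1) dvd ((2 * n) choose n)"
    by (simp add: coprime_dvd_mult_right_iff)
  thus ?thesis
    unfolding catalan_def by (rule dvd_mult_div_cancel)
qed

(* The type int poly has no inverse operation, so the fps division is unavailable.
   A quotient by a series with constant coefficient 1 is a product with the
   library's fps_right_inverse, which is its multiplicative inverse: *)
lemma fps_right_inverse_one_minus_X:
  fixes f :: "int poly fps"
  shows "(1 - fps_X * f) * fps_right_inverse (1 - fps_X * f) 1 = 1"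
  by (rule fps_right_inverse) simp

end

theory Submission
  imports Defs
begin

text \<open>
  Write a nonempty 132-avoiding permutation as \<open>A' @ M # B\<close> with \<open>M\<close> its largest entry. An entry
  of \<open>A'\<close> below an entry of \<open>B\<close> would form a 132 with \<open>M\<close> between them, so everything in \<open>A'\<close>
  exceeds everything in \<open>B\<close>: with \<open>m = length B\<close>, the word \<open>B\<close> is a 132-avoiding permutation of
  \<open>{1..m}\<close> and \<open>A'\<close> is one of \<open>{1..n - m}\<close> raised by \<open>m\<close>. Conversely every such pair gives a
  132-avoiding permutation (\<open>sum_S132_Suc\<close>).

  For \<open>k \<ge> 1\<close> the maximum never matches \<open>MMP(k,0,0,l)\<close>. An entry of \<open>B\<close> sees to its right only
  entries of \<open>B\<close>. An entry of \<open>A'\<close> sees, besides what it sees in \<open>A'\<close>, one larger entry \<open>M\<close> and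
  \<open>m\<close> smaller entries, those of \<open>B\<close>; it therefore matches exactly if it matches
  \<open>MMP(k-1,0,0,l-m)\<close> inside \<open>A'\<close>, with truncated subtraction. This gives a recurrence
  (\<open>Qn132_Suc\<close>) for the coefficients. In its terms with \<open>m < l\<close>, the word \<open>B\<close> is too short to
  contain a match and contributes only the number of choices for \<open>B\<close>, which is the Catalan
  number \<open>C\<^sub>m\<close>; in the others the first factor has last parameter \<open>0\<close>. In generating functions,
  with \<open>Q = Q132 k 0 0 l\<close> and \<open>P d = Q132 (k-1) 0 0 d\<close>, this says (\<open>Q132_functional_equation\<close>)
  that \<open>Q\<close> equals
  \<open>1 + t (\<Sum>m<l. C\<^sub>m t\<^sup>m P (l-m)) + t P 0 (Q - (\<Sum>m<l. C\<^sub>m t\<^sup>m))\<close>.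

  Solving for \<open>Q\<close> gives the claimed denominator \<open>1 - t P 0\<close> and the numerator
  \<open>1 + t (\<Sum>m<l. C\<^sub>m t\<^sup>m (P (l-m) - P 0))\<close>. The claimed numerator has the same terms in \<open>P\<close>, and
  its remaining terms \<open>C\<^sub>l t\<^sup>l + (\<Sum>j<l. C\<^sub>j t\<^sup>j) - t (\<Sum>j<l. \<Sum>s<l-j. C\<^sub>j C\<^sub>s t\<^sup>j\<^sup>+\<^sup>s)\<close> collapse
  to \<open>1\<close> by the Catalan recurrence (\<open>catalan_truncated_convolution\<close>).
\<close>

section \<open>The Catalan recurrence\<close>

lemma catalan_Suc_ratio: "(n + 2) * catalan (Suc n) = 2 * (2 * n + 1) * catalan n"
proof -
  have e1: "Suc n * (2 * Suc n choose Suc n) = (2 * Suc n) * (Suc (2 * n) choose n)"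
    using Suc_times_binomial_eq[of "Suc (2 * n)" n] by (simp add: mult.commute)
  have e2: "Suc n * (Suc (2 * n) choose n) = (2 * n + 1) * (2 * n choose n)"
    using binomial_absorb_comp[of "Suc (2 * n)" n] by simp
  have "Suc n * Suc n * (2 * Suc n choose Suc n) = 2 * Suc n * ((2 * n + 1) * (2 * n choose n))"
    using e1 e2 by (metis mult.assoc mult.left_commute)
  also have "(2 * n choose n) = Suc n * catalan n"
    using catalan_exact[of n] by simp
  also have "(2 * Suc n choose Suc n) = (n + 2) * catalan (Suc n)"
    using catalan_exact[of "Suc n"] by simp
  finally have "Suc n * Suc n * ((n + 2) * catalan (Suc n)) =
                Suc n * Suc n * (2 * (2 * n + 1) * catalan n)"
    by (simp only: mult_ac)
  thus ?thesis
    by (simp del: mult_Suc mult_Suc_right)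
qed

text \<open>
  The left-hand side is the coefficient of \<open>t\<^sup>n\<^sup>+\<^sup>1\<close> in \<open>(1 - 4t)\<^sup>1\<^sup>/\<^sup>2\<close>, so this is the generating
  function \<open>(1 - (1 - 4t)\<^sup>1\<^sup>/\<^sup>2) / (2t)\<close> of the Catalan numbers read off coefficientwise.
\<close>

lemma gbinomial_half_catalan:
  "((1/2 :: rat) gchoose Suc n) * (-4) ^ Suc n = - 2 * of_nat (catalan n)"
proof (induction n)
  case 0
  show ?case by (simp add: catalan_def)
next
  case (Suc n)
  have "(of_nat n + 2) * (((1/2 :: rat) gchoose Suc (Suc n)) * (-4) ^ Suc (Suc n))
      = (of_nat (Suc (Suc n)) * ((1/2 :: rat) gchoose Suc (Suc n))) * (-4) ^ Suc (Suc n)"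
    by (simp add: algebra_simps)
  also have "of_nat (Suc (Suc n)) * ((1/2 :: rat) gchoose Suc (Suc n)) =
             (1/2 - of_nat (Suc n)) * ((1/2 :: rat) gchoose Suc n)"
    using gbinomial_mult_1[of "1/2 :: rat" "Suc n"]
    by (simp only: left_diff_distrib eq_diff_eq add.commute)
  also have "\<dots> * (-4) ^ Suc (Suc n) = 2 * (2 * of_nat n + 1) * (((1/2 :: rat) gchoose Suc n) * (-4) ^ Suc n)"
    by (simp add: algebra_simps)
  also have "\<dots> = - 2 * of_nat (2 * (2 * n + 1) * catalan n)"
    by (simp only: Suc.IH) (simp add: algebra_simps)
  also have "\<dots> = (of_nat n + 2) * (- 2 * of_nat (catalan (Suc n)))"
    by (simp only: catalan_Suc_ratio[symmetric]) (simp add: algebra_simps)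
  finally have "(of_nat n + 2) * (((1/2 :: rat) gchoose Suc (Suc n)) * (-4) ^ Suc (Suc n)) =
      (of_nat n + 2) * (- 2 * of_nat (catalan (Suc n)))" .
  moreover have "(of_nat n + 2 :: rat) \<noteq> 0"
    using of_nat_0_le_iff[of n, where 'a = rat] by linarith
  ultimately show ?case
    by (rule mult_left_cancel[THEN iffD1, rotated])
qed

text \<open>
  Squaring \<open>(1 - 4t)\<^sup>1\<^sup>/\<^sup>2\<close> gives \<open>1 - 4t\<close>, whose coefficients vanish from degree 2 on; Vandermonde's
  identity states this for the coefficients of the square root.
\<close>

lemma catalan_recurrence: "catalan (Suc n) = (\<Sum>i\<le>n. catalan i * catalan (n - i))"
proof -
  define s where "s i = ((1/2 :: rat) gchoose i) * (-4) ^ i" for i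
  have s0: "s 0 = 1" and sS: "\<And>i. s (Suc i) = - 2 * of_nat (catalan i)"
    unfolding s_def using gbinomial_half_catalan by simp_all
  have "(\<Sum>i\<le>Suc (Suc n). s i * s (Suc (Suc n) - i)) =
        (\<Sum>i\<le>Suc (Suc n). ((1/2 gchoose i) * (1/2 gchoose (Suc (Suc n) - i))) * (-4) ^ Suc (Suc n))"
    unfolding s_def by (intro sum.cong refl) (simp add: power_add[symmetric] mult_ac)
  also have "\<dots> = (1 gchoose Suc (Suc n)) * (-4) ^ Suc (Suc n)"
    using gbinomial_Vandermonde[of "1/2 :: rat" "1/2" "Suc (Suc n)"]
    by (simp only: sum_distrib_right[symmetric] atLeast0AtMost) simp
  also have "(1 gchoose Suc (Suc n)) = (0 :: rat)"
    using binomial_gbinomial[of 1 "Suc (Suc n)", where 'a = rat] by simp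
  finally have "0 = (\<Sum>i\<le>Suc (Suc n). s i * s (Suc (Suc n) - i))"
    by simp
  also have "\<dots> = s (Suc (Suc n)) + (\<Sum>i\<le>Suc n. s (Suc i) * s (Suc n - i))"
    by (subst sum.atMost_Suc_shift) (simp add: s0)
  also have "(\<Sum>i\<le>Suc n. s (Suc i) * s (Suc n - i)) =
             s (Suc (Suc n)) + (\<Sum>i\<le>n. s (Suc i) * s (Suc (n - i)))"
    by (simp add: s0 Suc_diff_le)
  also have "(\<Sum>i\<le>n. s (Suc i) * s (Suc (n - i))) =
             4 * of_nat (\<Sum>i\<le>n. catalan i * catalan (n - i))"
    by (simp add: sS sum_distrib_left mult_ac)
  finally have "of_nat (catalan (Suc n)) =
      (of_nat (\<Sum>i\<le>n. catalan i * catalan (n - i)) :: rat)"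
    unfolding sS by linarith
  thus ?thesis
    by (simp only: of_nat_eq_iff)
qed

text \<open>
  By the recurrence, the terms with \<open>j + s = m\<close> add up to the Catalan term of degree \<open>m + 1\<close>. The
  truncation \<open>s < l - j\<close> keeps exactly the degrees \<open>m < l\<close>, so no incomplete convolution is left
  over.
\<close>

lemma catalan_truncated_convolution:
  fixes X :: "'a :: comm_semiring_1"
  shows "1 + (\<Sum>j<l. of_nat (catalan j) * X ^ j *
               (X * (\<Sum>s<l - j. of_nat (catalan s) * X ^ s)))
       = (\<Sum>j\<le>l. of_nat (catalan j) * X ^ j)"
proof -
  let ?c = "\<lambda>j. of_nat (catalan j) :: 'a"
  have "(\<Sum>j<l. ?c j * X ^ j * (X * (\<Sum>s<l - j. ?c s * X ^ s)))
      = (\<Sum>j<l. \<Sum>s<l - j. ?c j * ?c s * X ^ Suc (j + s))"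
    by (simp add: sum_distrib_left power_add mult_ac)
  also have "\<dots> = (\<Sum>(j, s)\<in>{(j, s). j + s < l}. ?c j * ?c s * X ^ Suc (j + s))"
    by (subst sum.Sigma) (auto intro!: sum.cong)
  also have "\<dots> = (\<Sum>m<l. \<Sum>j\<le>m. ?c j * ?c (m - j) * X ^ Suc (j + (m - j)))"
    by (rule sum.triangle_reindex)
  also have "\<dots> = (\<Sum>m<l. ?c (Suc m) * X ^ Suc m)"
    by (intro sum.cong refl) (simp add: catalan_recurrence sum_distrib_right del: power_Suc)
  finally show ?thesis
    by (simp only: lessThan_Suc_atMost[symmetric] sum.lessThan_Suc_shift) (simp add: catalan_def)
qed

section \<open>Avoidance and matches by recursion on words\<close>

lemma avoids_132_Nil [simp]: "avoids_132 []"
  by (simp add: avoids_132_def)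

lemma avoids_132_Cons:
  "avoids_132 (x # xs) \<longleftrightarrow> avoids_132 xs \<and> sorted_wrt (\<lambda>u v. \<not> (x < v \<and> v < u)) xs"
proof
  assume L: "avoids_132 (x # xs)"
  have *: "\<not> ((x # xs) ! i1 < (x # xs) ! i3 \<and> (x # xs) ! i3 < (x # xs) ! i2)"
    if "i1 < i2" "i2 < i3" "i3 < length (x # xs)" for i1 i2 i3
    using L that unfolding avoids_132_def by blast
  have "\<not> (xs ! i1 < xs ! i3 \<and> xs ! i3 < xs ! i2)"
    if "i1 < i2" "i2 < i3" "i3 < length xs" for i1 i2 i3
    using *[of "Suc i1" "Suc i2" "Suc i3"] that by simp
  moreover have "\<not> (x < xs ! j \<and> xs ! j < xs ! i)" if "i < j" "j < length xs" for i j
    using *[of 0 "Suc i" "Suc j"] that by simp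
  ultimately show "avoids_132 xs \<and> sorted_wrt (\<lambda>u v. \<not> (x < v \<and> v < u)) xs"
    by (auto simp: avoids_132_def sorted_wrt_iff_nth_less)
next
  assume R: "avoids_132 xs \<and> sorted_wrt (\<lambda>u v. \<not> (x < v \<and> v < u)) xs"
  have "\<not> ((x # xs) ! i1 < (x # xs) ! i3 \<and> (x # xs) ! i3 < (x # xs) ! i2)"
    if lt: "i1 < i2" "i2 < i3" "i3 < length (x # xs)" for i1 i2 i3
  proof -
    obtain j2 j3 where j: "i2 = Suc j2" "i3 = Suc j3"
      using lt by (metis less_nat_zero_code not0_implies_Suc)
    show ?thesis
      using R lt j by (cases i1) (auto simp: avoids_132_def sorted_wrt_iff_nth_less)
  qed
  thus "avoids_132 (x # xs)"
    unfolding avoids_132_def by blast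
qed

lemma mmp_Nil [simp]: "mmp a b c d [] = 0"
  by (simp add: mmp_def)

lemma card_positions_Cons:
  "card {i. i < length (x # xs) \<and> P i} =
   of_bool (P 0) + card {i. i < length xs \<and> P (Suc i)}"
proof -
  have "{i. i < length (x # xs) \<and> P i} =
        (if P 0 then {0} else {}) \<union> Suc ` {i. i < length xs \<and> P (Suc i)}"
    by (auto simp: less_Suc_eq_0_disj image_iff)
  thus ?thesis
    by (simp add: card_image card_insert_if)
qed

lemma card_later_Cons:
  "card {j. Suc i < j \<and> j < length (x # xs) \<and> P ((x # xs) ! j)} =
   card {j. i < j \<and> j < length xs \<and> P (xs ! j)}"
proof -
  have "j \<in> {j. Suc i < j \<and> j < length (x # xs) \<and> P ((x # xs) ! j)} \<longleftrightarrow>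
        j \<in> Suc ` {j. i < j \<and> j < length xs \<and> P (xs ! j)}" for j
    by (cases j) auto
  hence "{j. Suc i < j \<and> j < length (x # xs) \<and> P ((x # xs) ! j)} =
         Suc ` {j. i < j \<and> j < length xs \<and> P (xs ! j)}"
    by blast
  thus ?thesis
    by (simp add: card_image)
qed

lemma card_later_Cons_0:
  "card {j. 0 < j \<and> j < length (x # xs) \<and> P ((x # xs) ! j)} = length (filter P xs)"
proof -
  have "{j. 0 < j \<and> j < length (x # xs) \<and> P ((x # xs) ! j)} =
        Suc ` {j. j < length xs \<and> P (xs ! j)}"
    by (auto simp: image_iff gr0_conv_Suc)
  thus ?thesis
    by (simp add: card_image length_filter_conv_card)
qed

text \<open>
  With both middle parameters \<open>0\<close> only entries to the right matter, so prepending an entry leaves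
  the status of all others unchanged.
\<close>

lemma mmp_Cons:
  "mmp k 0 0 l (x # xs) =
   of_bool (k \<le> length (filter (\<lambda>y. y > x) xs) \<and> l \<le> length (filter (\<lambda>y. y < x) xs))
   + mmp k 0 0 l xs"
proof -
  have "matches_MMP k 0 0 l (x # xs) (Suc i) \<longleftrightarrow> matches_MMP k 0 0 l xs i" for i
    using card_later_Cons[of i x xs "\<lambda>y. y > xs ! i"]
      card_later_Cons[of i x xs "\<lambda>y. y < xs ! i"]
    by (simp add: matches_MMP_def)
  moreover have "matches_MMP k 0 0 l (x # xs) 0 \<longleftrightarrow>
      k \<le> length (filter (\<lambda>y. y > x) xs) \<and> l \<le> length (filter (\<lambda>y. y < x) xs)"
    using card_later_Cons_0[of x xs "\<lambda>y. y > x"] card_later_Cons_0[of x xs "\<lambda>y. y < x"]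
    by (simp add: matches_MMP_def)
  ultimately show ?thesis
    unfolding mmp_def card_positions_Cons by simp
qed

text \<open>A match needs \<open>l\<close> entries to its right, hence at least \<open>l + 1\<close> entries altogether.\<close>

lemma mmp_eq_0_if_short:
  assumes "length xs \<le> l" and "l \<ge> 1"
  shows "mmp k 0 0 l xs = 0"
  using assms
proof (induction xs)
  case (Cons x xs)
  have "length (filter (\<lambda>y. y < x) xs) < l"
    by (rule le_less_trans[OF length_filter_le]) (use Cons.prems in simp)
  thus ?case
    using Cons by (simp add: mmp_Cons)
qed simp

section \<open>Decomposition at the maximum\<close>

definition glue :: "nat list \<Rightarrow> nat list \<Rightarrow> nat list" where
  "glue A B = map (\<lambda>x. x + length B) A @ Suc (length A + length B) # B"

lemma length_glue: "length (glue A B) = Suc (length A + length B)"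
  by (simp add: glue_def)

lemma length_S132: "\<sigma> \<in> S132 n \<Longrightarrow> length \<sigma> = n"
  by (auto simp: S132_def dest: length_finite_permutations_of_set)

lemma S132_iff: "\<sigma> \<in> S132 n \<longleftrightarrow> set \<sigma> = {1..n} \<and> distinct \<sigma> \<and> avoids_132 \<sigma>"
  by (auto simp: S132_def permutations_of_set_def)

lemma finite_S132 [simp]: "finite (S132 n)"
  by (simp add: S132_def)

lemma S132_0 [simp]: "S132 0 = {[]}"
  by (auto simp: S132_iff)

lemma sorted_wrt_if_bounded:
  fixes a :: nat
  assumes "\<forall>v\<in>set xs. v \<le> a"
  shows "sorted_wrt (\<lambda>u v. \<not> (a < v \<and> v < u)) xs"
  using assms by (induction xs) auto

lemma avoids_132_append_max:
  assumes "\<forall>x\<in>set A. x + b < M" "\<forall>y\<in>set B. y < M" "\<forall>x\<in>set A. \<forall>y\<in>set B. y < x + b"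
  shows "avoids_132 (map (\<lambda>x. x + b) A @ M # B) \<longleftrightarrow> avoids_132 A \<and> avoids_132 B"
  using assms
proof (induction A)
  case Nil
  have "sorted_wrt (\<lambda>u v. \<not> (M < v \<and> v < u)) B"
    using Nil by (intro sorted_wrt_if_bounded) auto
  thus ?case by (simp add: avoids_132_Cons)
next
  case (Cons a A)
  have B: "sorted_wrt (\<lambda>u v. \<not> (a + b < v \<and> v < u)) B"
    using Cons.prems by (intro sorted_wrt_if_bounded) auto
  have "sorted_wrt (\<lambda>u v. \<not> (a + b < v \<and> v < u)) (map (\<lambda>x. x + b) A @ M # B) \<longleftrightarrow>
        sorted_wrt (\<lambda>u v. \<not> (a < v \<and> v < u)) A"
    using Cons.prems B by (force simp: sorted_wrt_append sorted_wrt_map)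
  thus ?case
    using Cons by (auto simp: avoids_132_Cons)
qed

text \<open>
  The bounds say that \<open>M\<close> is the maximum and that the part before it lies above the part after it.
  Passing to the whole word, an entry of \<open>A\<close> gains exactly one larger entry to its right, \<open>M\<close>,
  and exactly \<open>length B\<close> smaller ones.
\<close>

lemma mmp_append_max:
  assumes "\<forall>x\<in>set A. x + b < M" "\<forall>y\<in>set B. y < M" "\<forall>x\<in>set A. \<forall>y\<in>set B. y < x + b"
    and "k \<ge> 1"
  shows "mmp k 0 0 l (map (\<lambda>x. x + b) A @ M # B) =
         mmp (k - 1) 0 0 (l - length B) A + mmp k 0 0 l B"
  using assms(1-3)
proof (induction A)
  case Nil
  hence "filter (\<lambda>y. y > M) B = []"
    by (auto simp: filter_empty_conv)
  thus ?case
    using assms(4) by (simp add: mmp_Cons)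
next
  case (Cons a A)
  have "filter (\<lambda>y. y > a + b) B = []" "filter (\<lambda>y. y < a + b) B = B"
    using Cons.prems by (auto simp: filter_empty_conv filter_id_conv)
  hence "length (filter (\<lambda>y. y > a + b) (map (\<lambda>x. x + b) A @ M # B)) =
         Suc (length (filter (\<lambda>y. y > a) A))"
    and "length (filter (\<lambda>y. y < a + b) (map (\<lambda>x. x + b) A @ M # B)) =
         length (filter (\<lambda>y. y < a) A) + length B"
    using Cons.prems by (simp_all add: filter_map o_def)
  thus ?case
    using Cons assms(4) by (simp add: mmp_Cons le_diff_conv)
qed

lemma glue_bounds:
  assumes "A \<in> S132 a" and "B \<in> S132 b"
  shows "\<forall>x\<in>set A. x + length B < Suc (length A + length B)"
    and "\<forall>y\<in>set B. y < Suc (length A + length B)"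
    and "\<forall>x\<in>set A. \<forall>y\<in>set B. y < x + length B"
  using assms by (auto simp: length_S132 S132_iff)

lemma mmp_glue:
  assumes "A \<in> S132 a" and "B \<in> S132 b" and "k \<ge> 1"
  shows "mmp k 0 0 l (glue A B) = mmp (k - 1) 0 0 (l - b) A + mmp k 0 0 l B"
  unfolding glue_def
  using mmp_append_max[OF glue_bounds[OF assms(1,2)] assms(3)] assms(2) by (simp add: length_S132)

lemma glue_in_S132:
  assumes "A \<in> S132 a" and "B \<in> S132 b"
  shows "glue A B \<in> S132 (Suc (a + b))"
proof -
  note [simp] = length_S132[OF assms(1)] length_S132[OF assms(2)]
  have A: "set A = {1..a}" "distinct A" and B: "set B = {1..b}" "distinct B"
    using assms by (auto simp: S132_iff)
  have "avoids_132 (glue A B)"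
    unfolding glue_def using avoids_132_append_max[OF glue_bounds[OF assms]] assms
    by (simp add: S132_iff)
  moreover have "set (map (\<lambda>x. x + length B) A) = {Suc b..a + b}"
    using A by (simp add: add.commute)
  hence "set (glue A B) = {1..Suc (a + b)}" "distinct (glue A B)"
    unfolding glue_def using A B by (auto simp: distinct_map inj_on_def)
  ultimately show ?thesis
    by (simp add: S132_iff)
qed

lemma glue_inject:
  assumes "glue A B = glue A' B'" and "length B = length B'"
  shows "A = A' \<and> B = B'"
proof -
  have "length A = length A'"
    using arg_cong[OF assms(1), of length] assms(2) by (simp add: length_glue)
  hence "map (\<lambda>x. x + length B) A = map (\<lambda>x. x + length B) A'" and "B = B'"
    using assms by (simp_all add: glue_def)
  moreover have "inj (\<lambda>x. x + length B)"
    by (simp add: inj_on_def)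
  ultimately show ?thesis
    by (metis inj_map_eq_map)
qed

lemma lower_part_of_interval:
  fixes S T :: "nat set"
  assumes ST: "S \<union> T = {1..n}" and "\<forall>x\<in>S. \<forall>y\<in>T. y < x"
  shows "T = {1..card T} \<and> S = {Suc (card T)..n}"
proof -
  define m where "m = (if T = {} then 0 else Max T)"
  have fin: "finite T"
    using ST by (metis finite_Un finite_atLeastAtMost)
  have "T = {1..m}"
  proof (cases "T = {}")
    case False
    have "m \<in> T" and le: "\<And>y. y \<in> T \<Longrightarrow> y \<le> m"
      using False fin by (simp_all add: m_def)
    have "z \<in> T" if "z \<in> {1..m}" for z
      using assms \<open>m \<in> T\<close> that by (metis Un_iff atLeastAtMost_iff le_trans not_less)
    thus ?thesis
      using ST le by fastforce
  qed (simp add: m_def)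
  moreover have "S = {1..n} - T"
    using assms by blast
  moreover have "T \<subseteq> {1..n}"
    using ST by blast
  ultimately show ?thesis
    by auto
qed

lemma S132_Suc_is_glue:
  assumes "\<sigma> \<in> S132 (Suc n)"
  obtains m A B where "m \<le> n" "A \<in> S132 (n - m)" "B \<in> S132 m" "\<sigma> = glue A B"
proof -
  have \<sigma>: "set \<sigma> = {1..Suc n}" "distinct \<sigma>" "avoids_132 \<sigma>"
    using assms by (auto simp: S132_iff)
  have "Suc n \<in> set \<sigma>"
    by (simp add: \<sigma>(1))
  then obtain A' B where split: "\<sigma> = A' @ Suc n # B"
    by (blast dest: split_list)
  have "insert (Suc n) (set A' \<union> set B) = {1..Suc n}"
    using \<sigma>(1) by (simp add: split)
  moreover have "Suc n \<notin> set A' \<union> set B"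
    using \<sigma>(2) by (simp add: split)
  ultimately have "set A' \<union> set B = {1..Suc n} - {Suc n}"
    by (metis Diff_insert_absorb)
  also have "\<dots> = {1..n}"
    by auto
  finally have un: "set A' \<union> set B = {1..n}" .
  have below: "y < x" if x: "x \<in> set A'" and y: "y \<in> set B" for x y
  proof (rule ccontr)
    assume "\<not> y < x"
    moreover have "x \<noteq> y"
      using x y \<sigma>(2) by (auto simp: split)
    ultimately have "x < y"
      by simp
    moreover have "y < Suc n"
      using y un by (metis UnCI atLeastAtMost_iff le_imp_less_Suc)
    moreover obtain i where "i < length A'" "A' ! i = x"
      using x by (metis in_set_conv_nth)
    moreover obtain j where "j < length B" "B ! j = y"
      using y by (metis in_set_conv_nth)
    ultimately have "i < length A'" "length A' < length A' + Suc j" "length A' + Suc j < length \<sigma>"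
      "\<sigma> ! i < \<sigma> ! (length A' + Suc j)" "\<sigma> ! (length A' + Suc j) < \<sigma> ! length A'"
      by (simp_all add: split nth_append)
    thus False
      using \<sigma>(3) unfolding avoids_132_def by blast
  qed
  define m where "m = length B"
  have dist: "distinct A'" "distinct B"
    using \<sigma>(2) by (simp_all add: split)
  hence card: "card (set B) = m"
    by (simp add: m_def distinct_card)
  have B: "set B = {1..m}" and A': "set A' = {Suc m..n}"
    using lower_part_of_interval[OF un] below card by auto
  have "m \<le> n"
    using B un by (cases m) auto
  define A where "A = map (\<lambda>x. x - m) A'"
  have map_A: "map (\<lambda>x. x + m) A = A'"
    unfolding A_def map_map using A' by (intro map_idI) auto
  have lenA': "length A' = n - m"
    using distinct_card[OF dist(1)] A' by simp
  have dA: "distinct A"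
    using dist(1) unfolding map_A[symmetric] by (simp add: distinct_map)
  have "(\<lambda>x. x + m) ` set A = {Suc m..n}"
    using map_A A' by (metis list.set_map)
  also have "\<dots> = (\<lambda>x. x + m) ` {1..n - m}"
    using \<open>m \<le> n\<close> by simp
  finally have "(\<lambda>x. x + m) ` set A = (\<lambda>x. x + m) ` {1..n - m}" .
  moreover have "inj (\<lambda>x. x + m)"
    by (simp add: inj_on_def)
  ultimately have sA: "set A = {1..n - m}"
    by (rule inj_image_eq_iff[THEN iffD1, rotated])
  have "glue A B = \<sigma>"
    using map_A \<open>m \<le> n\<close> lenA' by (simp add: glue_def split A_def m_def[symmetric])
  moreover have "avoids_132 A \<and> avoids_132 B"
  proof (rule avoids_132_append_max[THEN iffD1])
    show "\<forall>x\<in>set A. x + m < Suc n" "\<forall>y\<in>set B. y < Suc n" "\<forall>x\<in>set A. \<forall>y\<in>set B. y < x + m"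
      unfolding sA B using \<open>m \<le> n\<close> by auto
    show "avoids_132 (map (\<lambda>x. x + m) A @ Suc n # B)"
      using \<sigma>(3) unfolding split map_A .
  qed
  ultimately show thesis
    using that[of m A B] \<open>m \<le> n\<close> sA dA B dist(2) by (simp add: S132_iff)
qed

text \<open>
  The decomposition as a bijection, stated for sums so that it serves both the count of all
  132-avoiding permutations (\<open>f = 1\<close>) and the polynomials \<open>Qn132\<close>.
\<close>

lemma sum_S132_Suc:
  "(\<Sum>\<sigma>\<in>S132 (Suc n). f \<sigma>) = (\<Sum>m\<le>n. \<Sum>A\<in>S132 (n - m). \<Sum>B\<in>S132 m. f (glue A B))"
proof -
  let ?D = "SIGMA m:{..n}. S132 (n - m) \<times> S132 m"
  have inj: "m = m' \<and> A = A' \<and> B = B'"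
    if *: "A \<in> S132 (n - m)" "B \<in> S132 m" "A' \<in> S132 (n - m')" "B' \<in> S132 m'"
      "m \<le> n" "m' \<le> n" "glue A B = glue A' B'" for m A B m' A' B'
  proof -
    have [simp]: "length A = n - m" "length B = m" "length A' = n - m'" "length B' = m'"
      using * by (auto simp: length_S132)
    \<comment> \<open>The maximum \<open>Suc n\<close> occurs only once in the common word, so the parts before and after
        it agree.\<close>
    have mem: "set (map (\<lambda>x. x + length B) A) \<subseteq> {..n}" "set B \<subseteq> {..n}"
      "set (map (\<lambda>x. x + length B') A') \<subseteq> {..n}" "set B' \<subseteq> {..n}"
      using * by (auto simp: S132_iff)
    have "map (\<lambda>x. x + length B) A @ Suc n # B = map (\<lambda>x. x + length B') A' @ Suc n # B'"
      using * by (simp add: glue_def length_S132)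
    hence "B = B'"
      using mem by (subst (asm) append_Cons_eq_iff) auto
    hence len: "length B = length B'"
      by (rule arg_cong)
    hence "m = m'"
      by simp
    thus ?thesis
      using glue_inject[OF *(7) len] by simp
  qed
  have "inj_on (\<lambda>(m, A, B). glue A B) ?D"
  proof (rule inj_onI)
    fix p q
    assume pq: "p \<in> ?D" "q \<in> ?D"
      "(\<lambda>(m, A, B). glue A B) p = (\<lambda>(m, A, B). glue A B) q"
    obtain m A B m' A' B' where [simp]: "p = (m, A, B)" "q = (m', A', B')"
      by (cases p, cases q)
    show "p = q"
      using pq inj[where m = m and A = A and B = B and m' = m' and A' = A' and B' = B'] by simp
  qed
  moreover have "(\<lambda>(m, A, B). glue A B) ` ?D = S132 (Suc n)"
  proof (intro equalityI subsetI)
    fix \<sigma> assume "\<sigma> \<in> S132 (Suc n)"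
    then obtain m A B where "m \<le> n" "A \<in> S132 (n - m)" "B \<in> S132 m" "\<sigma> = glue A B"
      by (rule S132_Suc_is_glue)
    then show "\<sigma> \<in> (\<lambda>(m, A, B). glue A B) ` ?D"
      by (intro image_eqI[of _ _ "(m, A, B)"]) simp_all
  next
    fix \<sigma> assume "\<sigma> \<in> (\<lambda>(m, A, B). glue A B) ` ?D"
    then obtain m A B where "m \<le> n" "A \<in> S132 (n - m)" "B \<in> S132 m" "\<sigma> = glue A B"
      by auto
    then show "\<sigma> \<in> S132 (Suc n)"
      using glue_in_S132[of A "n - m" B m] by simp
  qed
  ultimately have "bij_betw (\<lambda>(m, A, B). glue A B) ?D (S132 (Suc n))"
    by (simp add: bij_betw_def)
  hence "(\<Sum>\<sigma>\<in>S132 (Suc n). f \<sigma>) = (\<Sum>(m, A, B)\<in>?D. f (glue A B))"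
    using sum.reindex_bij_betw[of "\<lambda>(m, A, B). glue A B" ?D "S132 (Suc n)" f]
    by (simp add: case_prod_unfold)
  also have "\<dots> = (\<Sum>m\<le>n. \<Sum>A\<in>S132 (n - m). \<Sum>B\<in>S132 m. f (glue A B))"
    by (simp add: sum.Sigma sum.cartesian_product)
  finally show ?thesis .
qed

text \<open>Counting by the decomposition gives the recurrence of the Catalan numbers.\<close>

lemma card_S132: "card (S132 n) = catalan n"
proof (induction n rule: less_induct)
  case (less n)
  show ?case
  proof (cases n)
    case 0
    thus ?thesis by (simp add: catalan_def)
  next
    case (Suc n')
    have "card (S132 n) = (\<Sum>m\<le>n'. card (S132 (n' - m)) * card (S132 m))"
      using sum_S132_Suc[of "\<lambda>_. 1 :: nat" n'] by (simp add: Suc)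
    also have "\<dots> = (\<Sum>m\<le>n'. catalan m * catalan (n' - m))"
      using less Suc by (intro sum.cong refl) (simp add: mult.commute)
    finally show ?thesis
      by (simp add: Suc catalan_recurrence)
  qed
qed

section \<open>The generating function\<close>

lemma Qn132_Suc:
  assumes "k \<ge> 1"
  shows "Qn132 k 0 0 l (Suc n) =
         (\<Sum>m\<le>n. Qn132 k 0 0 l m * Qn132 (k - 1) 0 0 (l - m) (n - m))"
proof -
  have "Qn132 k 0 0 l (Suc n) = (\<Sum>m\<le>n. \<Sum>A\<in>S132 (n - m). \<Sum>B\<in>S132 m.
          monom 1 (mmp (k - 1) 0 0 (l - m) A) * monom 1 (mmp k 0 0 l B))"
    unfolding Qn132_def sum_S132_Suc
    by (intro sum.cong refl) (simp add: mmp_glue[OF _ _ assms] mult_monom)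
  also have "\<dots> = (\<Sum>m\<le>n. Qn132 k 0 0 l m * Qn132 (k - 1) 0 0 (l - m) (n - m))"
    unfolding Qn132_def
    by (intro sum.cong refl, subst sum.swap) (simp add: sum_product mult.commute)
  finally show ?thesis .
qed

lemma Qn132_short:
  assumes "n \<le> l" and "l \<ge> 1"
  shows "Qn132 k 0 0 l n = of_nat (catalan n)"
  using assms by (simp add: Qn132_def mmp_eq_0_if_short length_S132 card_S132)

lemma Q132_nth: "fps_nth (Q132 a b c d) n = Qn132 a b c d n"
  by (simp add: Q132_def Qn132_def)

text \<open>
  This is the recurrence \<open>Qn132_Suc\<close> split at \<open>m = l\<close>, where the truncated difference \<open>l - m\<close>
  becomes \<open>0\<close>: subtracting the Catalan terms from \<open>Q132 k 0 0 l\<close> leaves exactly its coefficients from \<open>l\<close> on.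
\<close>

lemma Q132_functional_equation:
  assumes "k \<ge> 1" and "l \<ge> 1"
  shows "Q132 k 0 0 l =
    1 + fps_X * (\<Sum>m<l. of_nat (catalan m) * fps_X ^ m * Q132 (k - 1) 0 0 (l - m))
      + fps_X * (Q132 (k - 1) 0 0 0 *
          (Q132 k 0 0 l - (\<Sum>m<l. of_nat (catalan m) * fps_X ^ m)))"
    (is "?Q = 1 + fps_X * ?L + fps_X * (?P0 * ?R)")
proof (rule fps_ext)
  fix n
  show "fps_nth ?Q n = fps_nth (1 + fps_X * ?L + fps_X * (?P0 * ?R)) n"
  proof (cases n)
    case 0
    thus ?thesis by (simp add: Q132_def)
  next
    case (Suc n')
    have coeff: "fps_nth (of_nat (catalan m) * fps_X ^ m * f) i =
        (if m \<le> i then of_nat (catalan m) * fps_nth f (i - m) else 0)" for m i and f :: "int poly fps"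
      by (simp add: fps_of_nat[symmetric] mult.assoc fps_X_power_mult_nth)
    have R: "fps_nth ?R m = (if m < l then 0 else Qn132 k 0 0 l m)" for m
    proof -
      have "fps_nth (\<Sum>m<l. of_nat (catalan m) * fps_X ^ m :: int poly fps) m =
            (\<Sum>i<l. if i = m then of_nat (catalan m) else 0)"
        unfolding fps_sum_nth using coeff[of _ 1] by (intro sum.cong refl) auto
      also have "\<dots> = (if m < l then of_nat (catalan m) else 0)"
        by simp
      finally show ?thesis
        using assms(2) by (simp add: Q132_nth Qn132_short)
    qed
    \<comment> \<open>The sum over \<open>m < l\<close> in \<open>?L\<close> and the sum over \<open>m \<le> n'\<close> in a Cauchy product only meet in
        \<open>m < l, m \<le> n'\<close>.\<close>
    have "fps_nth ?L n' = (\<Sum>m<l. if m \<le> n' then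
            of_nat (catalan m) * Qn132 (k - 1) 0 0 (l - m) (n' - m) else 0)"
      unfolding fps_sum_nth coeff Q132_nth ..
    also have "\<dots> = (\<Sum>m\<in>{..<l} \<inter> {..n'}.
            of_nat (catalan m) * Qn132 (k - 1) 0 0 (l - m) (n' - m))"
      by (subst sum.inter_restrict) simp_all
    also have "\<dots> = (\<Sum>m\<in>{..n'} \<inter> {..<l}.
            of_nat (catalan m) * Qn132 (k - 1) 0 0 (l - m) (n' - m))"
      by (simp only: Int_commute)
    also have "\<dots> = (\<Sum>m\<le>n'. if m < l then
            of_nat (catalan m) * Qn132 (k - 1) 0 0 (l - m) (n' - m) else 0)"
      by (subst sum.inter_restrict) simp_all
    finally have "fps_nth ?L n' + fps_nth (?P0 * ?R) n' =
        (\<Sum>m\<le>n'. (if m < l then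
            of_nat (catalan m) * Qn132 (k - 1) 0 0 (l - m) (n' - m) else 0)
          + fps_nth ?R m * Qn132 (k - 1) 0 0 0 (n' - m))"
      by (simp only: mult.commute[of ?P0] fps_mult_nth Q132_nth atLeast0AtMost sum.distrib)
    also have "\<dots> = (\<Sum>m\<le>n'. Qn132 k 0 0 l m * Qn132 (k - 1) 0 0 (l - m) (n' - m))"
      using assms(2) by (intro sum.cong refl, unfold R) (simp add: Qn132_short)
    also have "\<dots> = fps_nth ?Q n"
      by (simp add: Suc Q132_nth Qn132_Suc[OF assms(1)])
    finally show ?thesis
      by (simp add: Suc)
  qed
qed

theorem theorem11:
  fixes k l :: nat
  assumes "k \<ge> 1" and "l \<ge> 1"
  shows "Q132 k 0 0 l =
    (of_nat (catalan l) * fps_X ^ l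
      + (\<Sum>j = 0..l - 1. of_nat (catalan j) * fps_X ^ j *
          (1 - fps_X * Q132 (k - 1) 0 0 0
           + fps_X * (Q132 (k - 1) 0 0 (l - j)
                      - (\<Sum>s = 0..l - j - 1. of_nat (catalan s) * fps_X ^ s)))))
    * fps_right_inverse (1 - fps_X * Q132 (k - 1) 0 0 0) 1"
proof -
  define Q where "Q = Q132 k 0 0 l"
  define P where "P d = Q132 (k - 1) 0 0 d" for d
  define c :: "nat \<Rightarrow> int poly fps" where "c j = of_nat (catalan j) * fps_X ^ j" for j
  define I where "I = fps_right_inverse (1 - fps_X * P 0) 1"
  define L where "L = (\<Sum>j<l. c j * P (l - j))"
  define S where "S = (\<Sum>j<l. c j)"
  define V where "V = (\<Sum>j<l. c j * (fps_X * (\<Sum>s<l - j. c s)))"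
  have atLeastAtMost_pred: "{0..m - 1} = {..<m}" if "m > 0" for m :: nat
    using that by auto
  have "(\<Sum>j = 0..l - 1. c j * (1 - fps_X * P 0 + fps_X * (P (l - j) - (\<Sum>s = 0..l - j - 1. c s))))
      = (\<Sum>j<l. c j * (1 - fps_X * P 0 + fps_X * (P (l - j) - (\<Sum>s<l - j. c s))))"
    using less_le_trans[OF zero_less_one assms(2)]
    by (intro sum.cong) (simp_all only: atLeastAtMost_pred lessThan_iff zero_less_diff)
  also have "\<dots> = (\<Sum>j<l. (1 - fps_X * P 0) * c j + fps_X * (c j * P (l - j))
                      - c j * (fps_X * (\<Sum>s<l - j. c s)))"
    by (intro sum.cong refl) (simp add: algebra_simps)
  also have "\<dots> = (1 - fps_X * P 0) * S + fps_X * L - V"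
    by (simp only: sum.distrib sum_subtractf sum_distrib_left[symmetric] S_def L_def V_def)
  finally have numerator:
    "c l + (\<Sum>j = 0..l - 1. c j * (1 - fps_X * P 0 + fps_X * (P (l - j) - (\<Sum>s = 0..l - j - 1. c s))))
      = c l + ((1 - fps_X * P 0) * S + fps_X * L - V)"
    by simp
  have "1 + V = S + c l"
    using catalan_truncated_convolution[where l = l and X = "fps_X :: int poly fps"]
    by (simp add: V_def S_def c_def lessThan_Suc_atMost[symmetric])
  hence collapse: "c l = 1 + V - S"
    by simp
  have "Q = 1 + fps_X * L + fps_X * (P 0 * (Q - S))"
    using Q132_functional_equation[OF assms] unfolding Q_def P_def L_def S_def c_def .
  hence "Q * (1 - fps_X * P 0) = 1 + fps_X * L - fps_X * (P 0 * S)"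
    by (simp add: algebra_simps)
  hence solved: "Q * (1 - fps_X * P 0) = c l + ((1 - fps_X * P 0) * S + fps_X * L - V)"
    unfolding collapse by (simp add: algebra_simps)
  have "Q = Q * ((1 - fps_X * P 0) * I)"
    by (simp add: I_def fps_right_inverse_one_minus_X)
  also have "\<dots> = (c l + ((1 - fps_X * P 0) * S + fps_X * L - V)) * I"
    unfolding solved[symmetric] by (simp only: mult.assoc)
  finally show ?thesis
    unfolding numerator[symmetric] unfolding Q_def P_def c_def I_def .
qed

end
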